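(* Let $H$ be a real Hilbert space and let $B\colon H\rightrightarrows H$ be maximally monotone with resolvent $J_B:=(\mathrm{Id}+B)^{-1}\colon H\to H$. For $y\in H$ set $x:=J_B(y)$. Then the following are equivalent. (i) $B$ is proto-differentiable at $x$ relative to $y-x\in B(x)$, and the proto-derivative $D_pB(x\,|\,y-x)\colon H\rightrightarrows H$ is maximally monotone. (ii) $J_B$ is directionally differentiable at $y$, i.e., the limit $$J_B'(y;h)=\lim_{\tau\searrow 0}\frac{J_B(y+\tau h)-J_B(y)}{\tau}$$ exists for all $h\in H$.
   Context: For a set-valued operator $A\colon H\rightrightarrows H$ on a real Hilbert space $H$, $\operatorname{graph}(A)=\{(x,v)\in H\times H: v\in A(x)\}$. $A$ is monotone if $\langle v_1-v_2,x_1-x_2\rangle\ge 0$ for all $(x_1,v_1),(x_2,v_2)\in\operatorname{graph}(A)$, and maximally monotone if moreover its graph is not properly contained in the graph of another monotone operator. The resolvent $J_B=(\mathrm{Id}+B)^{-1}$ of a maximally monotone $B$ is single-valued and defined on all of $H$; $x=J_B(y)$ means $y-x\in B(x)$. Proto-derivative: for $v\in A(x)$ and $\tau>0$ define the difference quotient operator $\Delta_\tau A(x\,|\,v)\colon H\rightrightarrows H$ by $\Delta_\tau A(x\,|\,v)(h):=\tau^{-1}\bigl(A(x+\tau h)-v\bigr)$. $A$ is proto-differentiable at $x$ relative to $v$ if the graphs of $\Delta_\tau A(x\,|\,v)$ converge in the Painlevé–Kuratowski sense (norm topology of $H\times H$) as $\tau\searrow0$, i.e., if the outer limit (all $(h,k)$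 such that for some sequence $\tau_j\searrow 0$ there are $(h_j,k_j)\in\operatorname{graph}(\Delta_{\tau_j}A(x\,|\,v))$ with $(h_j,k_j)\to(h,k)$) coincides with the inner limit (all $(h,k)$ such that for every sequence $\tau_j\searrow0$ there are $(h_j,k_j)\in\operatorname{graph}(\Delta_{\tau_j}A(x\,|\,v))$, for all sufficiently large $j$, with $(h_j,k_j)\to(h,k)$). The proto-derivative $D_pA(x\,|\,v)\colon H\rightrightarrows H$ is then the operator whose graph is this common limit. The limit in (ii) is taken in the norm of $H$. *)

theory Defs
  imports "HOL-Analysis.Analysis"
begin

text \<open>A set-valued operator on \<open>H\<close> is a function \<open>'a \<Rightarrow> 'a set\<close>.\<close>

definition op_graph :: "('a \<Rightarrow> 'a set) \<Rightarrow> ('a \<times> 'a) set" where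
  "op_graph A = {(x, v). v \<in> A x}"

definition monotone_op :: "('a::real_inner \<Rightarrow> 'a set) \<Rightarrow> bool" where
  "monotone_op A \<longleftrightarrow>
     (\<forall>(x1, v1) \<in> op_graph A. \<forall>(x2, v2) \<in> op_graph A. inner (v1 - v2) (x1 - x2) \<ge> 0)"

definition maximally_monotone :: "('a::real_inner \<Rightarrow> 'a set) \<Rightarrow> bool" where
  "maximally_monotone A \<longleftrightarrow>
     monotone_op A \<and> \<not> (\<exists>A'. monotone_op A' \<and> op_graph A \<subset> op_graph A')"

definition op_inverse :: "('a \<Rightarrow> 'a set) \<Rightarrow> 'a \<Rightarrow> 'a set" where
  "op_inverse A y = {x. y \<in> A x}"

text \<open>The operator \<open>(Id + B)\<^sup>-\<^sup>1\<close> is single-valued with full domain when \<open>B\<close> is maximally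
  monotone on a Hilbert space; \<open>resolvent B\<close> is the associated function and has no specified
  value at points where \<open>(Id + B)\<^sup>-\<^sup>1\<close> is not a singleton.\<close>

definition resolvent :: "('a::real_inner \<Rightarrow> 'a set) \<Rightarrow> 'a \<Rightarrow> 'a" where
  "resolvent B y = (THE x. x \<in> op_inverse (\<lambda>z. (\<lambda>v. z + v) ` B z) y)"

definition diff_quotient_op ::
  "('a::real_inner \<Rightarrow> 'a set) \<Rightarrow> 'a \<Rightarrow> 'a \<Rightarrow> real \<Rightarrow> 'a \<Rightarrow> 'a set" where
  "diff_quotient_op A x v \<tau> h = (\<lambda>w. (1 / \<tau>) *\<^sub>R (w - v)) ` A (x + \<tau> *\<^sub>R h)"

definition pos_null_seq :: "(nat \<Rightarrow> real) \<Rightarrow> bool" where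
  "pos_null_seq \<tau> \<longleftrightarrow> (\<forall>j. \<tau> j > 0) \<and> \<tau> \<longlonglongrightarrow> 0"

text \<open>Painleve-Kuratowski limits of a family of sets \<open>S \<tau>\<close> as \<open>\<tau>\<close> decreases to 0.\<close>

definition outer_limit :: "(real \<Rightarrow> 'b::topological_space set) \<Rightarrow> 'b set" where
  "outer_limit S = {p. \<exists>\<tau>. pos_null_seq \<tau> \<and> (\<exists>q. (\<forall>j. q j \<in> S (\<tau> j)) \<and> q \<longlonglongrightarrow> p)}"

definition inner_limit :: "(real \<Rightarrow> 'b::topological_space set) \<Rightarrow> 'b set" where
  "inner_limit S =
     {p. \<forall>\<tau>. pos_null_seq \<tau> \<longrightarrow> (\<exists>q. (\<forall>\<^sub>F j in sequentially. q j \<in> S (\<tau> j)) \<and> q \<longlonglongrightarrow> p)}"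

definition proto_differentiable :: "('a::real_inner \<Rightarrow> 'a set) \<Rightarrow> 'a \<Rightarrow> 'a \<Rightarrow> bool" where
  "proto_differentiable A x v \<longleftrightarrow>
     v \<in> A x \<and>
     outer_limit (\<lambda>\<tau>. op_graph (diff_quotient_op A x v \<tau>)) =
     inner_limit (\<lambda>\<tau>. op_graph (diff_quotient_op A x v \<tau>))"

text \<open>The outer limit is the common limit of the graphs, hence the graph of the proto-derivative,
  only if \<open>A\<close> is proto-differentiable at \<open>x\<close> relative to \<open>v\<close>.\<close>

definition proto_derivative :: "('a::real_inner \<Rightarrow> 'a set) \<Rightarrow> 'a \<Rightarrow> 'a \<Rightarrow> 'a \<Rightarrow> 'a set" where
  "proto_derivative A x v h =
     {k. (h, k) \<in> outer_limit (\<lambda>\<tau>. op_graph (diff_quotient_op A x v \<tau>))}"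

definition directionally_differentiable :: "('a::real_inner \<Rightarrow> 'a) \<Rightarrow> 'a \<Rightarrow> bool" where
  "directionally_differentiable f y \<longleftrightarrow>
     (\<forall>h. \<exists>d. ((\<lambda>\<tau>. (1 / \<tau>) *\<^sub>R (f (y + \<tau> *\<^sub>R h) - f y)) \<longlongrightarrow> d) (at_right (0::real)))"

end

theory Submission
  imports Defs
begin

text \<open>By Minty's theorem the graph of a maximally monotone operator \<open>A\<close> is
  \<open>{(J\<^sub>A w, w - J\<^sub>A w) | w}\<close>, with \<open>J\<^sub>A\<close> nonexpansive. In these coordinates the graph of the difference
  quotient \<open>\<Delta>\<^sub>\<tau> B(x | y - x)\<close> is \<open>{(\<delta>\<^sub>\<tau> w, w - \<delta>\<^sub>\<tau> w) | w}\<close>, where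
  \<open>\<delta>\<^sub>\<tau> w = (J\<^sub>B (y + \<tau> w) - J\<^sub>B y) / \<tau>\<close> is nonexpansive. Since the \<open>\<delta>\<^sub>\<tau>\<close> are equicontinuous,
  graph convergence amounts to pointwise convergence of \<open>\<delta>\<^sub>\<tau>\<close>; maximality of the proto-derivative
  says, again by Minty, that every \<open>w\<close> occurs in the limit.

  Minty's theorem is obtained from the Fitzpatrick function
  \<open>F(x, u) = sup {\<langle>x, b\<rangle> + \<langle>a, u\<rangle> - \<langle>a, b\<rangle> | (a, b) \<in> graph A}\<close>, which dominates \<open>\<langle>x, u\<rangle>\<close>. The function
  \<open>F + |\<cdot>|\<^sup>2 / 2\<close> is strongly convex and attains its minimum by completeness, and the minimiser
  \<open>(x\<^sub>0, u\<^sub>0)\<close> gives the point \<open>(- u\<^sub>0, - x\<^sub>0)\<close> of the graph, where \<open>x\<^sub>0 = - u\<^sub>0\<close>.\<close>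

section \<open>Minimising a strongly convex function through its epigraph\<close>

text \<open>\<open>C\<close> plays the role of the epigraph of a convex function; using the set
  instead of the function leaves room for the value infinity. The quadratic term makes minimising
  sequences Cauchy, so completeness replaces compactness.\<close>

lemma strongly_convex_minimizer:
  fixes C :: "('b::{real_inner, complete_space} \<times> real) set"
  assumes "convex C" "closed C" "C \<noteq> {}"
    and bdd: "\<And>z t. (z, t) \<in> C \<Longrightarrow> m0 \<le> t + (norm z)\<^sup>2 / 2"
  obtains z0 t0 where "(z0, t0) \<in> C"
    and "\<And>z t. (z, t) \<in> C \<Longrightarrow> t0 + (norm z0)\<^sup>2 / 2 \<le> t + (norm z)\<^sup>2 / 2"
proof -
  define f where "f p = snd p + (norm (fst p))\<^sup>2 / 2" for p :: "'b \<times> real"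
  define m where "m = Inf (f ` C)"
  have bb: "bdd_below (f ` C)"
    unfolding bdd_below_def f_def using bdd by (intro exI[of _ m0]) auto
  have m_le: "m \<le> f p" if "p \<in> C" for p
    unfolding m_def using that bb by (intro cInf_lower) auto
  have "\<exists>p\<in>C. f p < m + 1 / Suc n" for n
    using cInf_lessD[of "f ` C" "m + 1 / Suc n"] assms(3) by (auto simp: m_def)
  then obtain p where pC: "\<And>n. p n \<in> C" and pm: "\<And>n. f (p n) < m + 1 / Suc n"
    by metis
  \<comment> \<open>At the midpoint, \<open>f\<close> lies below the average of \<open>f a\<close>
    and \<open>f b\<close> by an eighth of the squared distance of the first components. It is still
    at least \<open>m\<close> there, and multiplying by 8 gives the bound.\<close>
  have close: "(norm (fst a - fst b))\<^sup>2 \<le> 4 * (f a - m) + 4 * (f b - m)"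
    if "a \<in> C" "b \<in> C" for a b
  proof -
    have "(1/2) *\<^sub>R a + (1/2) *\<^sub>R b \<in> C"
      using that assms(1) by (intro convexD) auto
    then have "m \<le> f ((1/2) *\<^sub>R a + (1/2) *\<^sub>R b)" by (rule m_le)
    also have "\<dots> = f a / 2 + f b / 2 - (norm (fst a - fst b))\<^sup>2 / 8"
      unfolding f_def power2_norm_eq_inner
      by (simp add: inner_simps inner_commute field_simps)
    finally show ?thesis by simp
  qed
  have f_lim: "(\<lambda>n. f (p n)) \<longlonglongrightarrow> m"
  proof (rule tendsto_sandwich[of "\<lambda>_. m" _ _ "\<lambda>n. m + 1 / Suc n"])
    show "(\<lambda>n. m + 1 / Suc n) \<longlonglongrightarrow> m"
      using tendsto_add[OF tendsto_const[of m] LIMSEQ_Suc[OF lim_1_over_n]] by simp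
  qed (use m_le[OF pC] pm in \<open>auto intro!: always_eventually intro: less_imp_le simp del: of_nat_Suc\<close>)
  have "Cauchy (\<lambda>n. fst (p n))"
  proof (rule CauchyI)
    fix e :: real
    assume "0 < e"
    \<comment> \<open>The two excesses over \<open>m\<close> enter \<open>close\<close> with factor
      4 each, so \<open>e^2 / 8\<close> makes the sum \<open>e^2\<close>.\<close>
    then have "\<forall>\<^sub>F n in sequentially. f (p n) < m + e\<^sup>2 / 8"
      using f_lim by (intro order_tendstoD(2)) auto
    then obtain N where N: "\<And>n. N \<le> n \<Longrightarrow> f (p n) < m + e\<^sup>2 / 8"
      by (auto simp: eventually_sequentially)
    have "norm (fst (p i) - fst (p j)) < e" if "N \<le> i" "N \<le> j" for i j
    proof (rule power_less_imp_less_base)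
      show "(norm (fst (p i) - fst (p j)))\<^sup>2 < e\<^sup>2"
        using close[OF pC pC, of i j] N[OF that(1)] N[OF that(2)] by simp
    qed (use \<open>0 < e\<close> in simp)
    then show "\<exists>M. \<forall>i\<ge>M. \<forall>j\<ge>M. norm (fst (p i) - fst (p j)) < e" by blast
  qed
  then obtain z0 where z0: "(\<lambda>n. fst (p n)) \<longlonglongrightarrow> z0"
    using Cauchy_convergent_iff convergent_def by blast
  \<comment> \<open>The second components converge because they are the values of \<open>f\<close>
    minus the quadratic term, and both of these converge.\<close>
  have "(\<lambda>n. f (p n) - (norm (fst (p n)))\<^sup>2 / 2) \<longlonglongrightarrow> m - (norm z0)\<^sup>2 / 2"
    by (intro tendsto_intros f_lim z0) auto
  then have "(\<lambda>n. snd (p n)) \<longlonglongrightarrow> m - (norm z0)\<^sup>2 / 2"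
    by (simp add: f_def)
  with z0 have "p \<longlonglongrightarrow> (z0, m - (norm z0)\<^sup>2 / 2)"
    using tendsto_Pair[OF z0] by fastforce
  then have "(z0, m - (norm z0)\<^sup>2 / 2) \<in> C"
    using assms(2) pC closed_sequentially by blast
  then show ?thesis
    by (rule that) (use m_le in \<open>force simp: f_def\<close>)
qed

text \<open>First-order optimality: comparing the minimiser with the point at parameter
  \<open>s\<close> on the segment to \<open>(z, t)\<close> and dividing by \<open>s\<close> leaves a
  quadratic remainder with factor \<open>s\<close>, which vanishes as \<open>s\<close> decreases to
  0.\<close>

lemma strongly_convex_variational:
  fixes C :: "('b::real_inner \<times> real) set"
  assumes "convex C" "(z0, t0) \<in> C" "(z, t) \<in> C"
    and min: "\<And>z t. (z, t) \<in> C \<Longrightarrow> t0 + (norm z0)\<^sup>2 / 2 \<le> t + (norm z)\<^sup>2 / 2"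
  shows "0 \<le> t - t0 + inner z0 (z - z0)"
proof -
  have bound: "0 \<le> t - t0 + inner z0 (z - z0) + s * ((norm (z - z0))\<^sup>2 / 2)"
    if s: "0 < s" "s < 1" for s :: real
  proof -
    have "(1 - s) *\<^sub>R (z0, t0) + s *\<^sub>R (z, t) \<in> C"
      using assms s by (intro convexD) auto
    from min[OF this[simplified]]
    have "0 \<le> s * (t - t0 + inner z0 (z - z0) + s * ((norm (z - z0))\<^sup>2 / 2))"
      unfolding power2_norm_eq_inner
      by (simp add: inner_simps inner_commute field_simps)
    then show ?thesis using s by (simp add: zero_le_mult_iff)
  qed
  have "((\<lambda>s. t - t0 + inner z0 (z - z0) + s * ((norm (z - z0))\<^sup>2 / 2))
      \<longlongrightarrow> t - t0 + inner z0 (z - z0) + 0 * ((norm (z - z0))\<^sup>2 / 2)) (at_right 0)"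
    by (intro tendsto_intros)
  moreover have "\<forall>\<^sub>F s in at_right (0::real). 0 < s \<and> s < 1"
    using eventually_at_right_real[of 0 1] by simp
  then have "\<forall>\<^sub>F s in at_right 0. 0 \<le> t - t0 + inner z0 (z - z0) + s * ((norm (z - z0))\<^sup>2 / 2)"
    by eventually_elim (use bound in auto)
  ultimately show ?thesis
    using tendsto_lowerbound[of _ _ "at_right (0::real)" 0] by fastforce
qed

section \<open>Maximal monotonicity and Minty's theorem\<close>

lemma monotone_opD:
  assumes "monotone_op A" "v1 \<in> A x1" "v2 \<in> A x2"
  shows "0 \<le> inner (v1 - v2) (x1 - x2)"
  using assms by (auto simp: monotone_op_def op_graph_def)

lemma monotone_opI:
  assumes "\<And>x1 v1 x2 v2. v1 \<in> A x1 \<Longrightarrow> v2 \<in> A x2 \<Longrightarrow> 0 \<le> inner (v1 - v2) (x1 - x2)"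
  shows "monotone_op A"
  using assms by (auto simp: monotone_op_def op_graph_def)

text \<open>Adjoining \<open>(p, q)\<close> to the graph keeps it monotone, so by maximality the
  pair is already there.\<close>

lemma maximally_monotoneD:
  assumes "maximally_monotone A"
    and rel: "\<And>a b. b \<in> A a \<Longrightarrow> 0 \<le> inner (b - q) (a - p)"
  shows "q \<in> A p"
proof (rule ccontr)
  assume "q \<notin> A p"
  define A' where "A' = A(p := insert q (A p))"
  have mon: "monotone_op A"
    using assms(1) by (simp add: maximally_monotone_def)
  have A': "b \<in> A' a \<longleftrightarrow> b \<in> A a \<or> (a = p \<and> b = q)" for a b
    by (auto simp: A'_def)
  have rel': "0 \<le> inner (q - b) (p - a)" if "b \<in> A a" for a b
    using rel[OF that] by (metis inner_minus_left inner_minus_right minus_diff_eq minus_minus)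
  have "monotone_op A'"
    unfolding monotone_op_def op_graph_def
    using rel rel' monotone_opD[OF mon] by (auto simp: A')
  moreover have "op_graph A \<subset> op_graph A'"
    using \<open>q \<notin> A p\<close> by (auto simp: op_graph_def A')
  ultimately show False
    using assms(1) by (auto simp: maximally_monotone_def)
qed

lemma maximally_monotone_surj_zero:
  fixes A :: "'a::{real_inner, complete_space} \<Rightarrow> 'a set"
  assumes max: "maximally_monotone A"
  shows "\<exists>p. - p \<in> A p"
proof -
  have mon: "monotone_op A"
    using assms by (simp add: maximally_monotone_def)
  \<comment> \<open>the epigraph of the Fitzpatrick function\<close>
  define C where "C = (\<Inter>(a, b) \<in> op_graph A.
    {(z, t). inner (fst z) b + inner a (snd z) - inner a b \<le> (t::real)})"
  have C_iff: "((x, u), t) \<in> C \<longleftrightarrow>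
      (\<forall>a b. b \<in> A a \<longrightarrow> inner x b + inner a u - inner a b \<le> t)" for x u t
    by (auto simp: C_def op_graph_def)
  have "convex {(z :: 'a \<times> 'a, t). inner (fst z) b + inner a (snd z) - inner a b \<le> (t::real)}" for a b
  proof (rule convexI, clarsimp simp: inner_simps)
    fix x u x' u' :: 'a and t t' r s :: real
    assume "inner x b + inner a u - inner a b \<le> t" "inner x' b + inner a u' - inner a b \<le> t'"
      and rs: "0 \<le> r" "0 \<le> s" "r + s = 1"
    then have "r * (inner x b + inner a u - inner a b) + s * (inner x' b + inner a u' - inner a b)
        \<le> r * t + s * t'"
      by (intro add_mono mult_left_mono) auto
    moreover have "r * inner a b + s * inner a b = inner a b"
      using rs(3) by (metis distrib_right mult_1)
    ultimately show "r * inner x b + s * inner x' b + (r * inner a u + s * inner a u') - inner a b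
        \<le> r * t + s * t'"
      by (simp add: algebra_simps)
  qed
  then have convC: "convex C"
    unfolding C_def by (auto intro!: convex_INT)
  have "closed {(z :: 'a \<times> 'a, t). inner (fst z) b + inner a (snd z) - inner a b \<le> (t::real)}" for a b
    unfolding case_prod_beta by (intro closed_Collect_le continuous_intros)
  then have closedC: "closed C"
    unfolding C_def by (auto intro!: closed_INT)
  have graph_C: "((a, b), inner a b) \<in> C" if "b \<in> A a" for a b
    unfolding C_iff
  proof (intro allI impI)
    fix a' b'
    assume "b' \<in> A a'"
    from monotone_opD[OF mon that this] show "inner a b' + inner a' b - inner a' b' \<le> inner a b"
      by (simp add: inner_simps inner_commute)
  qed
  \<comment> \<open>If this failed, \<open>(x, u)\<close> would be strictly monotonically related to
    every graph point. Maximality would put it into the graph, where it is not strictly related to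
    itself.\<close>
  have dominates: "inner x u \<le> t" if "((x, u), t) \<in> C" for x u t
  proof (rule ccontr)
    assume "\<not> inner x u \<le> t"
    have rel: "0 < inner (b - u) (a - x)" if "b \<in> A a" for a b
    proof -
      have "inner x b + inner a u - inner a b \<le> t"
        using \<open>((x, u), t) \<in> C\<close> that by (simp add: C_iff)
      with \<open>\<not> inner x u \<le> t\<close> show ?thesis
        by (simp add: inner_simps inner_commute)
    qed
    then have "u \<in> A x"
      by (intro maximally_monotoneD[OF max]) (auto intro: less_imp_le)
    from rel[OF this] show False by simp
  qed
  have "0 \<le> t + (norm z)\<^sup>2 / 2" if "(z, t) \<in> C" for z t
  proof -
    obtain x u where z: "z = (x, u)" by fastforce
    have "0 \<le> inner (x + u) (x + u)" by simp
    then have "0 \<le> 2 * inner x u + (norm z)\<^sup>2"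
      unfolding power2_norm_eq_inner z by (simp add: inner_simps inner_commute)
    with dominates[of x u t] that z show ?thesis by simp
  qed
  \<comment> \<open>An empty graph would satisfy the maximality criterion vacuously at every pair,
    so the graph has a point, and \<open>graph_C\<close> lifts it to \<open>C\<close>.\<close>
  moreover have "C \<noteq> {}"
    using graph_C maximally_monotoneD[OF max] by blast
  ultimately obtain z0 t0 where z0: "(z0, t0) \<in> C"
    and min: "\<And>z t. (z, t) \<in> C \<Longrightarrow> t0 + (norm z0)\<^sup>2 / 2 \<le> t + (norm z)\<^sup>2 / 2"
    using strongly_convex_minimizer[OF convC closedC, of 0] by metis
  obtain x0 u0 where z0_eq: "z0 = (x0, u0)" by fastforce
  \<comment> \<open>The variational inequality at \<open>((a, b), inner a b)\<close> is combined
    with \<open>inner x0 u0 \<le> t0\<close>; completing the square gives the lower bound.\<close>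
  have key: "inner (x0 + u0) (x0 + u0) \<le> inner (b - (- x0)) (a - (- u0))" if "b \<in> A a" for a b
    using strongly_convex_variational[OF convC z0 graph_C[OF that] min] dominates[of x0 u0 t0] z0
    by (simp add: z0_eq inner_simps inner_commute)
  have in_A: "- x0 \<in> A (- u0)"
    by (rule maximally_monotoneD[OF max]) (use key inner_ge_zero order_trans in blast)
  \<comment> \<open>Testing \<open>key\<close> at the graph point \<open>(- u0, - x0)\<close> itself
    makes its right-hand side zero.\<close>
  from key[OF this] have "\<not> 0 < inner (x0 + u0) (x0 + u0)"
    by (simp del: inner_gt_zero_iff)
  then have "x0 = - u0"
    unfolding inner_gt_zero_iff eq_neg_iff_add_eq_0 by (rule notnotD)
  with in_A show ?thesis by (intro exI[of _ x0]) simp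
qed

text \<open>Subtracting \<open>y\<close> from all values preserves maximal monotonicity and reduces
  the claim to \<open>maximally_monotone_surj_zero\<close>.\<close>

theorem minty:
  fixes A :: "'a::{real_inner, complete_space} \<Rightarrow> 'a set"
  assumes max: "maximally_monotone A"
  shows "\<exists>p. y - p \<in> A p"
proof -
  define A' where "A' p = {v. v + y \<in> A p}" for p
  have mon: "monotone_op A"
    using max by (simp add: maximally_monotone_def)
  have "monotone_op A'"
  proof (rule monotone_opI)
    show "0 \<le> inner (v1 - v2) (x1 - x2)" if "v1 \<in> A' x1" "v2 \<in> A' x2" for x1 v1 x2 v2
      using monotone_opD[OF mon, of "v1 + y" x1 "v2 + y" x2] that by (simp add: A'_def)
  qed
  moreover have "\<not> (\<exists>A''. monotone_op A'' \<and> op_graph A' \<subset> op_graph A'')"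
  proof (intro notI, elim exE conjE)
    fix A''
    assume A'': "monotone_op A''" "op_graph A' \<subset> op_graph A''"
    then obtain p v where "v \<in> A'' p" "v \<notin> A' p"
      by (auto simp: op_graph_def)
    have "v + y \<in> A p"
    proof (rule maximally_monotoneD[OF max])
      fix a b
      assume "b \<in> A a"
      then have "(a, b - y) \<in> op_graph A'" by (simp add: op_graph_def A'_def)
      then have "b - y \<in> A'' a" using A''(2) by (auto simp: op_graph_def)
      from monotone_opD[OF A''(1) this \<open>v \<in> A'' p\<close>]
      show "0 \<le> inner (b - (v + y)) (a - p)" by (simp add: algebra_simps)
    qed
    with \<open>v \<notin> A' p\<close> show False by (simp add: A'_def)
  qed
  ultimately have "maximally_monotone A'" by (simp add: maximally_monotone_def)
  from maximally_monotone_surj_zero[OF this] show ?thesis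
    by (simp add: A'_def)
qed

text \<open>Converse of Minty's theorem. For a pair \<open>(p, v)\<close> of a monotone extension,
  surjectivity supplies a pair of \<open>A\<close> with the same coordinate sum
  \<open>p + v\<close>. Two monotonically related pairs with equal sums coincide.\<close>

lemma maximally_monotoneI:
  assumes mon: "monotone_op A" and surj: "\<And>y. \<exists>p. y - p \<in> A p"
  shows "maximally_monotone A"
  unfolding maximally_monotone_def
proof (intro conjI mon notI, elim exE conjE)
  fix A'
  assume A': "monotone_op A'" "op_graph A \<subset> op_graph A'"
  then obtain p v where pv: "v \<in> A' p" "v \<notin> A p"
    by (auto simp: op_graph_def)
  obtain r where r: "(p + v) - r \<in> A r" using surj by blast
  then have "p + v - r \<in> A' r" using A'(2) by (auto simp: op_graph_def)
  from monotone_opD[OF A'(1) this pv(1)] have "inner (p - r) (r - p) \<ge> 0" by simp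
  then have "inner (p - r) (p - r) \<le> 0"
    by (metis inner_minus_right minus_diff_eq neg_0_le_iff_le)
  then have "p = r"
    unfolding not_less[symmetric] inner_gt_zero_iff by simp
  with r pv(2) show False by simp
qed

section \<open>Resolvents\<close>

lemma monotone_op_resolvent_nonexpansive:
  assumes "monotone_op A" "v - p \<in> A p" "w - q \<in> A q"
  shows "norm (p - q) \<le> norm (v - w)"
proof -
  from monotone_opD[OF assms] have "0 \<le> inner ((v - w) - (p - q)) (p - q)"
    by (simp add: algebra_simps)
  then have "norm (p - q) * norm (p - q) \<le> inner (v - w) (p - q)"
    by (simp add: inner_diff_left flip: power2_norm_eq_inner power2_eq_square)
  also have "\<dots> \<le> norm (v - w) * norm (p - q)" by (rule norm_cauchy_schwarz)
  finally show ?thesis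
    by (cases "p = q") simp_all
qed

text \<open>Justifies the definite description in \<open>resolvent\<close>: Minty's theorem gives
  existence, and nonexpansiveness with equal arguments gives uniqueness.\<close>

lemma resolvent_iff:
  fixes A :: "'a::{real_inner, complete_space} \<Rightarrow> 'a set"
  assumes max: "maximally_monotone A"
  shows "resolvent A y = p \<longleftrightarrow> y - p \<in> A p"
proof -
  have mon: "monotone_op A" using max by (simp add: maximally_monotone_def)
  have inv: "q \<in> op_inverse (\<lambda>z. (\<lambda>v. z + v) ` A z) y \<longleftrightarrow> y - q \<in> A q" for q
    unfolding op_inverse_def
    by (auto simp: image_iff) (metis add_diff_cancel_left' diff_add_cancel add.commute)+
  obtain r where r: "y - r \<in> A r" using minty[OF max] by blast
  have uniq: "q = r" if "y - q \<in> A q" for q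
    using monotone_op_resolvent_nonexpansive[OF mon that r] by simp
  have "resolvent A y = r"
    unfolding resolvent_def inv using r uniq by (rule the_equality)
  with r uniq[of p] show ?thesis by blast
qed

lemma resolvent_nonexpansive:
  fixes A :: "'a::{real_inner, complete_space} \<Rightarrow> 'a set"
  assumes "maximally_monotone A"
  shows "norm (resolvent A v - resolvent A w) \<le> norm (v - w)"
proof (rule monotone_op_resolvent_nonexpansive)
  show "monotone_op A" using assms by (simp add: maximally_monotone_def)
qed (simp_all flip: resolvent_iff[OF assms])

section \<open>Painleve-Kuratowski limits along null sequences\<close>

lemma pos_null_seq_inverse_Suc: "pos_null_seq (\<lambda>j. 1 / Suc j)"
  using LIMSEQ_Suc[OF lim_1_over_n[where 'a = real]] by (auto simp: pos_null_seq_def)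

lemma outer_limitI:
  "p \<in> outer_limit S" if "pos_null_seq \<tau>" "\<And>j. q j \<in> S (\<tau> j)" "q \<longlonglongrightarrow> p"
  unfolding outer_limit_def mem_Collect_eq
  using that by (intro exI[of _ \<tau>] conjI exI[of _ q]) auto

lemma outer_limitE:
  assumes "p \<in> outer_limit S"
  obtains \<tau> q where "pos_null_seq \<tau>" "\<forall>j. q j \<in> S (\<tau> j)" "q \<longlonglongrightarrow> p"
  using assms unfolding outer_limit_def mem_Collect_eq by metis

lemma inner_limit_subset_outer_limit: "inner_limit S \<subseteq> outer_limit S"
proof
  fix p
  assume "p \<in> inner_limit S"
  then obtain q where q: "\<forall>\<^sub>F j in sequentially. q j \<in> S (1 / Suc j)" "q \<longlonglongrightarrow> p"
    using pos_null_seq_inverse_Suc by (auto simp: inner_limit_def)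
  then obtain N where N: "\<And>j. N \<le> j \<Longrightarrow> q j \<in> S (1 / Suc j)"
    by (auto simp: eventually_sequentially)
  \<comment> \<open>The inner limit gives membership only eventually, the outer limit asks for it at
    every index; shifting by \<open>N\<close> bridges the gap.\<close>
  then have "q (j + N) \<in> S (1 / Suc (j + N))" for j by (simp del: of_nat_Suc)
  moreover have "pos_null_seq (\<lambda>j. 1 / Suc (j + N))"
    using pos_null_seq_inverse_Suc LIMSEQ_ignore_initial_segment[of "\<lambda>j. 1 / Suc j" "0::real" N]
    by (auto simp: pos_null_seq_def)
  moreover have "(\<lambda>j. q (j + N)) \<longlonglongrightarrow> p" using q(2) by (rule LIMSEQ_ignore_initial_segment)
  ultimately show "p \<in> outer_limit S" by (intro outer_limitI)
qed

lemma tendsto_at_right_zero_iff_pos_null_seq: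
  "(f \<longlongrightarrow> d) (at_right (0::real)) \<longleftrightarrow> (\<forall>\<tau>. pos_null_seq \<tau> \<longrightarrow> (\<lambda>j. f (\<tau> j)) \<longlonglongrightarrow> d)"
  for f :: "real \<Rightarrow> 'b::topological_space"
  unfolding tendsto_at_iff_sequentially pos_null_seq_def by (auto simp: o_def)

section \<open>Difference quotients of the operator and of its resolvent\<close>

lemma graph_diff_quotient_op_iff:
  fixes B :: "'a::{real_inner, complete_space} \<Rightarrow> 'a set"
  assumes max: "maximally_monotone B" and x: "x = resolvent B y" and "0 < \<tau>"
  shows "(h, k) \<in> op_graph (diff_quotient_op B x (y - x) \<tau>) \<longleftrightarrow>
    h = (1 / \<tau>) *\<^sub>R (resolvent B (y + \<tau> *\<^sub>R (h + k)) - resolvent B y)"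
proof -
  have "(h, k) \<in> op_graph (diff_quotient_op B x (y - x) \<tau>) \<longleftrightarrow>
      (y + \<tau> *\<^sub>R (h + k)) - (x + \<tau> *\<^sub>R h) \<in> B (x + \<tau> *\<^sub>R h)"
  proof -
    have "k = (1 / \<tau>) *\<^sub>R (w - (y - x)) \<longleftrightarrow> w = (y + \<tau> *\<^sub>R (h + k)) - (x + \<tau> *\<^sub>R h)" for w
      using \<open>0 < \<tau>\<close> unfolding eq_vector_fraction_iff by (auto simp: algebra_simps)
    then show ?thesis
      by (auto simp: op_graph_def diff_quotient_op_def image_iff)
  qed
  also have "\<dots> \<longleftrightarrow> resolvent B (y + \<tau> *\<^sub>R (h + k)) = x + \<tau> *\<^sub>R h"
    by (simp add: resolvent_iff[OF max])
  also have "\<dots> \<longleftrightarrow> h = (1 / \<tau>) *\<^sub>R (resolvent B (y + \<tau> *\<^sub>R (h + k)) - resolvent B y)"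
    unfolding x[symmetric] eq_vector_fraction_iff using \<open>0 < \<tau>\<close>
    by (auto simp: algebra_simps)
  finally show ?thesis .
qed

theorem theorem4:
  fixes B :: "'a::{real_inner, complete_space} \<Rightarrow> 'a set" and x y :: 'a
  assumes "maximally_monotone B"
    and "x = resolvent B y"
  shows "(proto_differentiable B x (y - x) \<and>
          maximally_monotone (proto_derivative B x (y - x)))
         \<longleftrightarrow> directionally_differentiable (resolvent B) y"
proof -
  define \<delta> where "\<delta> \<tau> w = (1 / \<tau>) *\<^sub>R (resolvent B (y + \<tau> *\<^sub>R w) - resolvent B y)" for \<tau> w
  define S where "S \<tau> = op_graph (diff_quotient_op B x (y - x) \<tau>)" for \<tau>
  have S_iff: "(h, k) \<in> S \<tau> \<longleftrightarrow> h = \<delta> \<tau> (h + k)" if "0 < \<tau>" for \<tau> h k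
    unfolding S_def \<delta>_def by (rule graph_diff_quotient_op_iff[OF assms that])
  have \<delta>_nonexp: "norm (\<delta> \<tau> v - \<delta> \<tau> w) \<le> norm (v - w)" if "0 < \<tau>" for \<tau> v w
  proof -
    have "norm (\<delta> \<tau> v - \<delta> \<tau> w) =
        norm (resolvent B (y + \<tau> *\<^sub>R v) - resolvent B (y + \<tau> *\<^sub>R w)) / \<tau>"
      using that by (simp add: \<delta>_def flip: scaleR_diff_right)
    also have "\<dots> \<le> norm ((y + \<tau> *\<^sub>R v) - (y + \<tau> *\<^sub>R w)) / \<tau>"
      using that by (intro divide_right_mono resolvent_nonexpansive[OF assms(1)]) auto
    also have "\<dots> = norm (v - w)"
      using that by (simp flip: scaleR_diff_right)
    finally show ?thesis .
  qed
  \<comment> \<open>Here \<open>fst (q j)\<close> is the resolvent quotient at the varying direction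
    \<open>fst (q j) + snd (q j)\<close>, which tends to \<open>w\<close>. Nonexpansiveness, uniform
    in \<open>\<tau>\<close>, permits replacing that direction by \<open>w\<close>.\<close>
  have \<delta>_lim: "(\<lambda>j. \<delta> (\<tau> j) w - fst (q j)) \<longlonglongrightarrow> 0"
    if \<tau>: "pos_null_seq \<tau>" and q: "\<forall>\<^sub>F j in sequentially. q j \<in> S (\<tau> j)" "q \<longlonglongrightarrow> (h, w - h)"
    for \<tau> q h w
  proof (rule Lim_null_comparison)
    have "(\<lambda>j. norm (w - (fst (q j) + snd (q j)))) \<longlonglongrightarrow> norm (w - (h + (w - h)))"
      using tendsto_fst[OF q(2)] tendsto_snd[OF q(2)] by (intro tendsto_intros) auto
    then show "(\<lambda>j. norm (w - (fst (q j) + snd (q j)))) \<longlonglongrightarrow> 0" by simp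
    show "\<forall>\<^sub>F j in sequentially. norm (\<delta> (\<tau> j) w - fst (q j)) \<le> norm (w - (fst (q j) + snd (q j)))"
      using q(1)
    proof eventually_elim
      case (elim j)
      have "0 < \<tau> j" using \<tau> by (simp add: pos_null_seq_def)
      with elim have "fst (q j) = \<delta> (\<tau> j) (fst (q j) + snd (q j))"
        using S_iff[of "\<tau> j" "fst (q j)" "snd (q j)"] by simp
      then show ?case using \<delta>_nonexp[OF \<open>0 < \<tau> j\<close>] by metis
    qed
  qed
  have dd: "directionally_differentiable (resolvent B) y \<longleftrightarrow>
      (\<forall>w. \<exists>d. \<forall>\<tau>. pos_null_seq \<tau> \<longrightarrow> (\<lambda>j. \<delta> (\<tau> j) w) \<longlonglongrightarrow> d)"
    unfolding directionally_differentiable_def tendsto_at_right_zero_iff_pos_null_seq \<delta>_def ..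
  have yx: "y - x \<in> B x"
    using resolvent_iff[OF assms(1)] assms(2) by blast
  have pd: "k \<in> proto_derivative B x (y - x) h \<longleftrightarrow> (h, k) \<in> outer_limit S" for h k
    by (simp add: proto_derivative_def S_def[abs_def])
  have pdiff: "proto_differentiable B x (y - x) \<longleftrightarrow> outer_limit S = inner_limit S"
    using yx by (simp add: proto_differentiable_def S_def[abs_def])
  show ?thesis
    unfolding pdiff
  proof
    assume *: "outer_limit S = inner_limit S \<and> maximally_monotone (proto_derivative B x (y - x))"
    show "directionally_differentiable (resolvent B) y"
      unfolding dd
    proof
      fix w
      \<comment> \<open>Minty's theorem for the proto-derivative makes every direction
        \<open>w\<close> the coordinate sum of a limit pair; its first component is the candidate
        derivative.\<close>
      obtain h where "(h, w - h) \<in> inner_limit S"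
        using minty[of "proto_derivative B x (y - x)" w] * by (auto simp: pd)
      then have "(\<lambda>j. \<delta> (\<tau> j) w) \<longlonglongrightarrow> h" if \<tau>: "pos_null_seq \<tau>" for \<tau>
      proof -
        obtain q where q: "\<forall>\<^sub>F j in sequentially. q j \<in> S (\<tau> j)" "q \<longlonglongrightarrow> (h, w - h)"
          using \<open>(h, w - h) \<in> inner_limit S\<close> \<tau> by (auto simp: inner_limit_def)
        show ?thesis
          using tendsto_add[OF \<delta>_lim[OF \<tau> q] tendsto_fst[OF q(2)]] by simp
      qed
      then show "\<exists>d. \<forall>\<tau>. pos_null_seq \<tau> \<longrightarrow> (\<lambda>j. \<delta> (\<tau> j) w) \<longlonglongrightarrow> d" by blast
    qed
  next
    assume "directionally_differentiable (resolvent B) y"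
    then obtain D where D: "\<And>w \<tau>. pos_null_seq \<tau> \<Longrightarrow> (\<lambda>j. \<delta> (\<tau> j) w) \<longlonglongrightarrow> D w"
      unfolding dd by metis
    \<comment> \<open>Along the sequence witnessing the outer limit, the quotients in direction
      \<open>h + k\<close> tend both to \<open>D (h + k)\<close> and to \<open>h\<close>.\<close>
    have outer: "h = D (h + k)" if hk: "(h, k) \<in> outer_limit S" for h k
    proof -
      obtain \<tau> q where \<tau>: "pos_null_seq \<tau>" and q: "\<forall>j. q j \<in> S (\<tau> j)" "q \<longlonglongrightarrow> (h, k)"
        using outer_limitE[OF hk] by blast
      have "(\<lambda>j. \<delta> (\<tau> j) (h + k) - fst (q j)) \<longlonglongrightarrow> 0"
        using q by (intro \<delta>_lim[OF \<tau>, where h = h]) auto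
      moreover have "(\<lambda>j. \<delta> (\<tau> j) (h + k) - fst (q j)) \<longlonglongrightarrow> D (h + k) - h"
        using tendsto_diff[OF D[OF \<tau>] tendsto_fst[OF q(2)]] by simp
      ultimately show ?thesis
        using LIMSEQ_unique by fastforce
    qed
    have in_S: "(\<delta> \<tau> w, w - \<delta> \<tau> w) \<in> S \<tau>" if "0 < \<tau>" for \<tau> w
      by (simp add: S_iff[OF that])
    have inner: "(D w, w - D w) \<in> inner_limit S" for w
      unfolding inner_limit_def
    proof (intro CollectI allI impI)
      fix \<tau>
      assume \<tau>: "pos_null_seq \<tau>"
      have "(\<lambda>j. (\<delta> (\<tau> j) w, w - \<delta> (\<tau> j) w)) \<longlonglongrightarrow> (D w, w - D w)"
        by (intro tendsto_intros D \<tau>)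
      then show "\<exists>q. (\<forall>\<^sub>F j in sequentially. q j \<in> S (\<tau> j)) \<and> q \<longlonglongrightarrow> (D w, w - D w)"
        using \<tau> in_S by (intro exI[of _ "\<lambda>j. (\<delta> (\<tau> j) w, w - \<delta> (\<tau> j) w)"])
          (auto simp: pos_null_seq_def)
    qed
    have outer_eq: "outer_limit S = inner_limit S"
    proof
      show "outer_limit S \<subseteq> inner_limit S"
      proof clarify
        fix h k
        assume "(h, k) \<in> outer_limit S"
        from outer[OF this] inner[of "h + k"] show "(h, k) \<in> inner_limit S"
          by (metis add_diff_cancel_left')
      qed
    qed (rule inner_limit_subset_outer_limit)
    have S_mono: "0 \<le> inner (k1 - k2) (h1 - h2)"
      if hk: "(h1, k1) \<in> S \<tau>" "(h2, k2) \<in> S \<tau>" and "0 < \<tau>" for h1 k1 h2 k2 \<tau>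
    proof -
      have mon: "monotone_op B" using assms(1) by (simp add: maximally_monotone_def)
      obtain w1 w2 where w: "w1 \<in> B (x + \<tau> *\<^sub>R h1)" "w2 \<in> B (x + \<tau> *\<^sub>R h2)"
        "k1 = (1 / \<tau>) *\<^sub>R (w1 - (y - x))" "k2 = (1 / \<tau>) *\<^sub>R (w2 - (y - x))"
        using hk by (auto simp: S_def op_graph_def diff_quotient_op_def)
      have "w1 - w2 = \<tau> *\<^sub>R (k1 - k2)"
        using \<open>0 < \<tau>\<close> w by (simp flip: scaleR_diff_right)
      moreover have "(x + \<tau> *\<^sub>R h1) - (x + \<tau> *\<^sub>R h2) = \<tau> *\<^sub>R (h1 - h2)"
        by (simp add: scaleR_diff_right)
      ultimately have "0 \<le> \<tau> * (\<tau> * inner (k1 - k2) (h1 - h2))"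
        using monotone_opD[OF mon w(1,2)] by simp
      then show ?thesis using \<open>0 < \<tau>\<close> by (simp add: zero_le_mult_iff)
    qed
    have "maximally_monotone (proto_derivative B x (y - x))"
    proof (rule maximally_monotoneI)
      show "\<exists>p. w - p \<in> proto_derivative B x (y - x) p" for w
        using inner outer_eq by (auto simp: pd)
      show "monotone_op (proto_derivative B x (y - x))"
        unfolding monotone_op_def op_graph_def pd
      proof clarsimp
        fix h1 k1 h2 k2
        assume "(h1, k1) \<in> outer_limit S" "(h2, k2) \<in> outer_limit S"
        then have h: "h1 = D (h1 + k1)" "h2 = D (h2 + k2)" using outer by auto
        \<comment> \<open>The outer limit may give the two pairs different sequences. By
          \<open>D\<close>, both are also limits along this common one, so monotonicity can be used
          inside a single quotient graph and passed to the limit.\<close>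
        define \<tau> :: "nat \<Rightarrow> real" where "\<tau> j = 1 / Suc j" for j
        have \<tau>: "pos_null_seq \<tau>"
          unfolding \<tau>_def[abs_def] by (rule pos_null_seq_inverse_Suc)
        have d: "(\<lambda>j. \<delta> (\<tau> j) (h1 + k1)) \<longlonglongrightarrow> h1" "(\<lambda>j. \<delta> (\<tau> j) (h2 + k2)) \<longlonglongrightarrow> h2"
          using D[OF \<tau>] h by metis+
        have "(\<lambda>j. inner ((h1 + k1 - \<delta> (\<tau> j) (h1 + k1)) - (h2 + k2 - \<delta> (\<tau> j) (h2 + k2)))
            (\<delta> (\<tau> j) (h1 + k1) - \<delta> (\<tau> j) (h2 + k2)))
          \<longlonglongrightarrow> inner ((h1 + k1 - h1) - (h2 + k2 - h2)) (h1 - h2)"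
          by (intro tendsto_intros d)
        moreover have "0 < \<tau> j" for j by (simp add: \<tau>_def)
        ultimately show "0 \<le> inner (k1 - k2) (h1 - h2)"
          using S_mono[OF in_S in_S] by (intro LIMSEQ_le_const) auto
      qed
    qed
    with outer_eq show "outer_limit S = inner_limit S \<and>
        maximally_monotone (proto_derivative B x (y - x))" by simp
  qed
qed

end
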